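(* Let $G=(V,E)$ be a finite graph with maximum degree at most $\Delta$ and let $n\geq 1$ be an integer. Then $C(I_n(G))\leq \Delta(n-1)$.
   Context: Graphs are finite, simple and undirected. For a graph $G=(V,E)$ and an integer $n\geq 1$, $I_n(G)$ is the simplicial complex $\{U\subseteq V:\ \alpha(G[U])<n\}$, where $G[U]$ is the induced subgraph and $\alpha$ the independence number. For a finite simplicial complex $X$, a face $\sigma$ contained in a unique maximal face $\tau$ is a free face; if $|\sigma|\leq d$, removing all faces $\eta$ with $\sigma\subseteq\eta\subseteq\tau$ is an elementary $d$-collapse. $X$ is $d$-collapsible if a sequence of elementary $d$-collapses reduces it to the void complex (no faces at all). The collapsibility number $C(X)$ is the minimum $d$ such that $X$ is $d$-collapsible.
   Formalization: The formal theorem assumes Δ ≥ 1; for Δ = 0 the claim is false: for two isolated vertices and n = 2, I_2(G) consists of two disjoint points, so C(I_2(G)) = 1 > 0 = Δ(n−1). *)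

theory Defs
  imports "HOL-Library.Ramsey"
begin

section \<open>Finite simple graphs\<close>

text \<open>
  A graph has a vertex set \<open>V\<close> and a set \<open>E\<close> of two-element subsets of \<open>V\<close>.
  Independent sets are given by \<^const>\<open>indep\<close>: no two distinct vertices of the set
  form an edge.
\<close>

definition finite_simple_graph :: "'a set \<Rightarrow> 'a set set \<Rightarrow> bool" where
  "finite_simple_graph V E \<longleftrightarrow> finite V \<and> E \<subseteq> [V]\<^bsup>2\<^esup>"

definition degree :: "'a set set \<Rightarrow> 'a \<Rightarrow> nat" where
  "degree E v = card {e \<in> E. v \<in> e}"

text \<open>The inserted \<open>0\<close> only matters for the graph without vertices.\<close>

definition max_degree :: "'a set \<Rightarrow> 'a set set \<Rightarrow> nat" where
  "max_degree V E = Max (insert 0 (degree E ` V))"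

definition independence_number :: "'a set \<Rightarrow> 'a set set \<Rightarrow> nat" where
  "independence_number V E = Max {card S | S. S \<subseteq> V \<and> indep S E}"

definition induced_edges :: "'a set \<Rightarrow> 'a set set \<Rightarrow> 'a set set" where
  "induced_edges U E = {e \<in> E. e \<subseteq> U}"

section \<open>Collapsibility of finite simplicial complexes\<close>

text \<open>
  An abstract simplicial complex is given by its set of faces. The void complex \<open>{}\<close>
  (no faces) differs from the complex \<open>{{}}\<close>, whose only face is the empty one.
\<close>

definition finite_simplicial_complex :: "'a set set \<Rightarrow> bool" where
  "finite_simplicial_complex X \<longleftrightarrow>
     finite X \<and> (\<forall>\<sigma>\<in>X. finite \<sigma>) \<and> (\<forall>\<sigma>\<in>X. \<forall>\<rho>. \<rho> \<subseteq> \<sigma> \<longrightarrow> \<rho> \<in> X)"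

definition maximal_face :: "'a set set \<Rightarrow> 'a set \<Rightarrow> bool" where
  "maximal_face X \<tau> \<longleftrightarrow> \<tau> \<in> X \<and> (\<forall>\<eta>\<in>X. \<tau> \<subseteq> \<eta> \<longrightarrow> \<eta> = \<tau>)"

text \<open>\<open>\<sigma>\<close> is a free face of \<open>X\<close>, and \<open>\<tau>\<close> is the only maximal face containing it;
  \<open>\<sigma> = \<tau>\<close> is allowed.\<close>

definition free_face :: "'a set set \<Rightarrow> 'a set \<Rightarrow> 'a set \<Rightarrow> bool" where
  "free_face X \<sigma> \<tau> \<longleftrightarrow>
     \<sigma> \<in> X \<and> maximal_face X \<tau> \<and> \<sigma> \<subseteq> \<tau> \<and>
     (\<forall>\<tau>'. maximal_face X \<tau>' \<and> \<sigma> \<subseteq> \<tau>' \<longrightarrow> \<tau>' = \<tau>)"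

definition elementary_collapse :: "nat \<Rightarrow> 'a set set \<Rightarrow> 'a set set \<Rightarrow> bool" where
  "elementary_collapse d X Y \<longleftrightarrow>
     (\<exists>\<sigma> \<tau>. free_face X \<sigma> \<tau> \<and> card \<sigma> \<le> d \<and> Y = X - {\<eta>. \<sigma> \<subseteq> \<eta> \<and> \<eta> \<subseteq> \<tau>})"

definition collapsible :: "nat \<Rightarrow> 'a set set \<Rightarrow> bool" where
  "collapsible d X \<longleftrightarrow> (elementary_collapse d)\<^sup>*\<^sup>* X {}"

text \<open>For finite simplicial complexes the minimum exists: see
  \<open>collapsible_collapsibility_number\<close> below.\<close>

definition collapsibility_number :: "'a set set \<Rightarrow> nat" where
  "collapsibility_number X = (LEAST d. collapsible d X)"

lemma collapsible_if_card_le: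
  assumes "finite X" "\<forall>\<sigma>\<in>X. finite \<sigma> \<and> card \<sigma> \<le> d"
  shows "collapsible d X"
  using assms
proof (induction "card X" arbitrary: X rule: less_induct)
  case less
  show ?case
  proof (cases "X = {}")
    case True
    then show ?thesis by (simp add: collapsible_def)
  next
    case False
    then obtain \<tau> where \<tau>: "\<tau> \<in> X" "\<forall>\<eta>\<in>X. \<tau> \<subseteq> \<eta> \<longrightarrow> \<eta> = \<tau>"
      using finite_has_maximal[OF less.prems(1) False] by blast
    have "free_face X \<tau> \<tau>"
      using \<tau> by (auto simp: free_face_def maximal_face_def)
    moreover have "X - {\<tau>} = X - {\<eta>. \<tau> \<subseteq> \<eta> \<and> \<eta> \<subseteq> \<tau>}" by auto
    moreover have "card \<tau> \<le> d" using less.prems(2) \<tau>(1) by simp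
    ultimately have "elementary_collapse d X (X - {\<tau>})"
      unfolding elementary_collapse_def by (intro exI conjI)
    moreover have "card (X - {\<tau>}) < card X"
      using less.prems(1) \<tau>(1) by (rule card_Diff1_less)
    hence "collapsible d (X - {\<tau>})"
      using less.hyps less.prems by simp
    ultimately show ?thesis
      unfolding collapsible_def by (rule converse_rtranclp_into_rtranclp)
  qed
qed

lemma collapsible_collapsibility_number:
  assumes "finite_simplicial_complex X"
  shows "collapsible (collapsibility_number X) X"
proof -
  have "collapsible (Max (card ` X)) X"
    using assms by (intro collapsible_if_card_le) (auto simp: finite_simplicial_complex_def)
  then show ?thesis unfolding collapsibility_number_def by (rule LeastI)
qed

section \<open>The complex of vertex sets with bounded independence number\<close>

definition bounded_independence_complex :: "nat \<Rightarrow> 'a set \<Rightarrow> 'a set set \<Rightarrow> 'a set set"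
  where "bounded_independence_complex n V E =
    {U. U \<subseteq> V \<and> independence_number U (induced_edges U E) < n}"

lemma indep_induced_edges:
  assumes "S \<subseteq> U"
  shows "indep S (induced_edges U E) \<longleftrightarrow> indep S E"
  using assms by (auto simp: indep_def induced_edges_def)

lemma independence_number_induced_less_iff:
  assumes "finite U"
  shows "independence_number U (induced_edges U E) < n \<longleftrightarrow>
    (\<forall>S\<subseteq>U. indep S E \<longrightarrow> card S < n)"
proof -
  let ?A = "{card S | S. S \<subseteq> U \<and> indep S (induced_edges U E)}"
  have "?A \<subseteq> card ` Pow U" by auto
  moreover have "finite (card ` Pow U)" using assms by simp
  ultimately have fin: "finite ?A" by (rule finite_subset)
  have "card ({} :: 'a set) \<in> ?A" by (rule CollectI) (intro exI[of _ "{}"], simp)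
  hence "?A \<noteq> {}" by (metis empty_iff)
  with fin have "independence_number U (induced_edges U E) < n \<longleftrightarrow> (\<forall>a\<in>?A. a < n)"
    unfolding independence_number_def by (rule Max_less_iff)
  also have "\<dots> \<longleftrightarrow> (\<forall>S. S \<subseteq> U \<and> indep S (induced_edges U E) \<longrightarrow> card S < n)"
    by blast
  also have "\<dots> \<longleftrightarrow> (\<forall>S\<subseteq>U. indep S E \<longrightarrow> card S < n)"
    using indep_induced_edges[of _ U E] by metis
  finally show ?thesis .
qed

lemma finite_simplicial_complex_bounded_independence_complex:
  assumes "finite V"
  shows "finite_simplicial_complex (bounded_independence_complex n V E)"
proof -
  have "bounded_independence_complex n V E =
      {U. U \<subseteq> V \<and> (\<forall>S\<subseteq>U. indep S E \<longrightarrow> card S < n)}"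
    using finite_subset[OF _ assms]
    by (auto simp: bounded_independence_complex_def independence_number_induced_less_iff)
  moreover have "finite (bounded_independence_complex n V E)"
    unfolding bounded_independence_complex_def using assms by simp
  moreover have "\<forall>U\<in>bounded_independence_complex n V E. finite U"
    using finite_subset[OF _ assms] by (simp add: bounded_independence_complex_def)
  ultimately show ?thesis
    unfolding finite_simplicial_complex_def by (simp, meson subset_trans)
qed

text \<open>
  The bound \<open>\<Delta> * (n - 1)\<close> fails for \<open>\<Delta> = 0\<close>: for two isolated vertices and \<open>n = 2\<close>
  the complex consists of two disjoint points, which is not \<open>0\<close>-collapsible.
\<close>

lemma max_degree_zero_counterexample:
  "finite_simple_graph {0, 1::nat} {}" "max_degree {0, 1::nat} {} = 0"
  "0 < collapsibility_number (bounded_independence_complex 2 {0, 1::nat} {})"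
proof -
  show "finite_simple_graph {0, 1::nat} {}" "max_degree {0, 1::nat} {} = 0"
    by (simp_all add: finite_simple_graph_def max_degree_def degree_def)
  let ?X = "bounded_independence_complex 2 {0, 1::nat} {}"
  have mem: "U \<in> ?X \<longleftrightarrow> U \<subseteq> {0, 1} \<and> (\<forall>S\<subseteq>U. card S < 2)" for U
    using independence_number_induced_less_iff[of U "{}" 2] finite_subset[of U "{0, 1}"]
    by (auto simp: bounded_independence_complex_def indep_def)
  have in_X: "{0} \<in> ?X" "{1} \<in> ?X"
    unfolding mem by (auto simp: subset_singleton_iff)
  have X: "U = {} \<or> U = {0} \<or> U = {1}" if "U \<in> ?X" for U
  proof -
    have "U \<subseteq> {0, 1}" "card U < 2" using that mem[of U] by blast+
    then have "U \<in> Pow {0, 1}" "card U < 2" by simp_all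
    then show ?thesis by (auto simp: Pow_insert)
  qed
  have "maximal_face ?X {v}" if "v \<in> {0, 1}" for v
    unfolding maximal_face_def
  proof (intro conjI ballI impI)
    show "{v} \<in> ?X" using that in_X by fastforce
    fix \<eta> assume "\<eta> \<in> ?X" and v: "{v} \<subseteq> \<eta>"
    from X[OF this(1)] v show "\<eta> = {v}" by auto
  qed
  from this[of 0] this[of 1] have max: "maximal_face ?X {0}" "maximal_face ?X {1}"
    by simp_all
  have "\<not> elementary_collapse 0 ?X Y" for Y
  proof
    assume "elementary_collapse 0 ?X Y"
    then obtain \<sigma> \<tau> where \<sigma>: "free_face ?X \<sigma> \<tau>" "card \<sigma> = 0"
      by (auto simp: elementary_collapse_def)
    have "\<sigma> \<in> ?X" using \<sigma>(1) by (simp add: free_face_def)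
    from X[OF this] \<sigma>(2) have "\<sigma> = {}" by auto
    with \<sigma>(1) have "\<tau>' = \<tau>" if "maximal_face ?X \<tau>'" for \<tau>'
      using that by (simp add: free_face_def)
    from this[OF max(1)] this[OF max(2)] have "{0::nat} = {1}" by (rule trans[OF _ sym])
    thus False by simp
  qed
  moreover have "?X \<noteq> {}" using in_X by blast
  ultimately have "\<not> collapsible 0 ?X"
    unfolding collapsible_def by (metis (no_types) converse_rtranclpE)
  moreover have "collapsible (collapsibility_number ?X) ?X"
    by (intro collapsible_collapsibility_number
        finite_simplicial_complex_bounded_independence_complex) simp
  ultimately show "0 < collapsibility_number ?X" by (metis gr0I)
qed

end

theory Submission
  imports Defs
begin

text \<open>
  Call \<open>U\<close> bad if it is minimal with \<open>card U > \<Delta> * \<alpha> U\<close>. If a vertex \<open>u\<close> of a bad set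
  had a neighbour outside, deleting \<open>u\<close> and its at most \<open>\<Delta> - 1\<close> neighbours inside would
  leave a smaller such set. So bad sets are unions of components; minimality
  makes them pairwise disjoint and gives \<open>card B = \<Delta> * \<alpha> B + 1\<close> and \<open>\<alpha> (B - {v}) = \<alpha> B\<close>
  for every \<open>v \<in> B\<close>.

  For each bad \<open>B\<close> fix \<open>v \<in> B\<close> and let \<open>P = B - {v}\<close>. The link of \<open>P\<close> is a cone with apex
  \<open>v\<close> over the complex of \<open>G - B\<close> with parameter \<open>n - \<alpha> B\<close>, hence inductively
  \<open>(\<Delta> * (n - 1) - card P)\<close>-collapsible, so all faces containing \<open>P\<close> can be collapsed away.
  Once this is done for every \<open>B\<close>, all remaining faces have at most \<open>\<Delta> * (n - 1)\<close> vertices.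
\<close>

section \<open>Collapsing cones and links\<close>

lemma elementary_collapse_subset: "elementary_collapse d X Y \<Longrightarrow> Y \<subseteq> X"
  by (auto simp: elementary_collapse_def)

text \<open>The family is the join of \<open>X\<close> with the full simplex on \<open>C\<close>. A
  free face \<sigma> of \<open>X\<close> stays free in the join, with \<tau> enlarged to \<tau>
  \<union> C, so every collapse lifts with the same \<sigma> and the bound \<open>d\<close> does not
  grow.\<close>

lemma collapsible_cone:
  assumes "collapsible d X" "\<And>\<sigma>. \<sigma> \<in> X \<Longrightarrow> \<sigma> \<inter> C = {}"
  shows "collapsible d {\<eta>. \<eta> - C \<in> X}"
proof -
  have "(elementary_collapse d)\<^sup>*\<^sup>* {\<eta>. \<eta> - C \<in> X} {}"
    using assms unfolding collapsible_def
  proof (induction rule: converse_rtranclp_induct)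
    case base
    then show ?case by simp
  next
    case (step X Y)
    obtain \<sigma> \<tau> where *: "free_face X \<sigma> \<tau>" "card \<sigma> \<le> d" "Y = X - {\<eta>. \<sigma> \<subseteq> \<eta> \<and> \<eta> \<subseteq> \<tau>}"
      using step.hyps(1) by (auto simp: elementary_collapse_def)
    let ?J = "{\<eta>. \<eta> - C \<in> X}"
    have \<sigma>: "\<sigma> \<in> X" "\<sigma> \<inter> C = {}" "\<sigma> \<subseteq> \<tau>" and \<tau>: "\<tau> \<in> X" "\<tau> \<inter> C = {}" "maximal_face X \<tau>"
      using *(1) step.prems by (auto simp: free_face_def maximal_face_def)
    \<comment> \<open>Adding \<open>C\<close> to a face of the join gives a face again, so a maximal
      face must contain all of \<open>C\<close>.\<close>
    have max: "maximal_face ?J \<eta> \<longleftrightarrow> maximal_face X (\<eta> - C) \<and> C \<subseteq> \<eta>" for \<eta>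
    proof
      assume m: "maximal_face ?J \<eta>"
      have "\<eta> \<union> C - C = \<eta> - C" by blast
      then have "\<eta> \<union> C \<in> ?J" using m by (simp add: maximal_face_def)
      then have "\<eta> \<union> C = \<eta>" using m unfolding maximal_face_def by blast
      then have C: "C \<subseteq> \<eta>" by blast
      have "\<rho> = \<eta> - C" if "\<rho> \<in> X" "\<eta> - C \<subseteq> \<rho>" for \<rho>
      proof -
        have "\<rho> \<inter> C = {}" using step.prems that by blast
        then have e: "\<rho> \<union> C - C = \<rho>" by blast
        moreover have "\<eta> \<subseteq> \<rho> \<union> C" using that by blast
        ultimately have "\<rho> \<union> C = \<eta>" using m \<open>\<rho> \<in> X\<close> by (simp add: maximal_face_def)
        with e show ?thesis by simp
      qed
      with m C show "maximal_face X (\<eta> - C) \<and> C \<subseteq> \<eta>" by (auto simp: maximal_face_def)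
    next
      assume m: "maximal_face X (\<eta> - C) \<and> C \<subseteq> \<eta>"
      have "\<rho> = \<eta>" if "\<rho> - C \<in> X" "\<eta> \<subseteq> \<rho>" for \<rho>
      proof -
        have "\<eta> - C \<subseteq> \<rho> - C" using that by blast
        then have "\<rho> - C = \<eta> - C" using m that by (auto simp: maximal_face_def)
        with m that show ?thesis by blast
      qed
      with m show "maximal_face ?J \<eta>" by (auto simp: maximal_face_def)
    qed
    have "free_face ?J \<sigma> (\<tau> \<union> C)"
      unfolding free_face_def max
    proof (intro conjI allI impI)
      have e: "\<sigma> - C = \<sigma>" "\<tau> \<union> C - C = \<tau>" using \<sigma> \<tau> by blast+
      show "\<sigma> \<in> ?J" "maximal_face X (\<tau> \<union> C - C)" using e \<sigma> \<tau> by simp_all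
      show "C \<subseteq> \<tau> \<union> C" "\<sigma> \<subseteq> \<tau> \<union> C" using \<sigma> by blast+
      fix \<tau>' assume t: "(maximal_face X (\<tau>' - C) \<and> C \<subseteq> \<tau>') \<and> \<sigma> \<subseteq> \<tau>'"
      then have "\<sigma> \<subseteq> \<tau>' - C" using \<sigma> by blast
      then have "\<tau>' - C = \<tau>" using t *(1) by (simp add: free_face_def)
      with t show "\<tau>' = \<tau> \<union> C" by blast
    qed
    \<comment> \<open>As \<sigma> misses \<open>C\<close>, it lies in \<eta> iff it lies in \<eta> -
      C; hence removing the interval commutes with forming the join.\<close>
    moreover have "{\<eta>. \<eta> - C \<in> Y} = ?J - {\<eta>. \<sigma> \<subseteq> \<eta> \<and> \<eta> \<subseteq> \<tau> \<union> C}"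
      unfolding *(3) using \<sigma>(2) by blast
    ultimately have "elementary_collapse d ?J {\<eta>. \<eta> - C \<in> Y}"
      using *(2) unfolding elementary_collapse_def by blast
    moreover have "(elementary_collapse d)\<^sup>*\<^sup>* {\<eta>. \<eta> - C \<in> Y} {}"
      using step.IH step.prems elementary_collapse_subset[OF step.hyps(1)] by blast
    ultimately show ?case by (rule converse_rtranclp_into_rtranclp)
  qed
  then show ?thesis by (simp add: collapsible_def)
qed

text \<open>Here \<open>L\<close> acts as the link of \<open>P\<close>, and its image under adding
  \<open>P\<close> is the set of all faces above \<open>P\<close>. Whether a face containing
  \<open>P\<close> is maximal depends on \<open>L\<close> alone, so a collapse sequence of
  \<open>L\<close> carries over, with sizes raised by at most \<open>card P\<close>.\<close>

lemma collapses_star: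
  assumes "(elementary_collapse d)\<^sup>*\<^sup>* L {}" "\<And>\<sigma>. \<sigma> \<in> L \<Longrightarrow> \<sigma> \<inter> P = {}"
    and X: "\<And>\<eta>. \<eta> \<in> X \<Longrightarrow> \<not> P \<subseteq> \<eta>"
  shows "(elementary_collapse (d + card P))\<^sup>*\<^sup>* (X \<union> (\<union>) P ` L) X"
  using assms(1,2)
proof (induction rule: converse_rtranclp_induct)
  case base
  then show ?case by simp
next
  case (step L M)
  obtain \<sigma> \<tau> where *: "free_face L \<sigma> \<tau>" "card \<sigma> \<le> d" "M = L - {\<eta>. \<sigma> \<subseteq> \<eta> \<and> \<eta> \<subseteq> \<tau>}"
    using step.hyps(1) by (auto simp: elementary_collapse_def)
  let ?J = "\<lambda>L. X \<union> (\<union>) P ` L"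
  have \<sigma>: "\<sigma> \<in> L" "\<sigma> \<subseteq> \<tau>" and \<tau>: "\<tau> \<in> L" "maximal_face L \<tau>"
    using *(1) by (auto simp: free_face_def maximal_face_def)
  \<comment> \<open>Disjointness from \<open>P\<close> makes \<rho> \<mapsto> P \<union> \<rho> an
    order embedding on \<open>L\<close>.\<close>
  have le: "P \<union> \<rho> \<subseteq> P \<union> \<eta> \<longleftrightarrow> \<rho> \<subseteq> \<eta>" if "\<rho> \<in> L" for \<rho> \<eta>
    using step.prems[OF that] by blast
  have max: "maximal_face (?J L) (P \<union> \<eta>) \<longleftrightarrow> maximal_face L \<eta>" if "\<eta> \<in> L" for \<eta>
  proof
    assume m: "maximal_face (?J L) (P \<union> \<eta>)"
    have "\<rho> = \<eta>" if "\<rho> \<in> L" "\<eta> \<subseteq> \<rho>" for \<rho>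
    proof -
      have "P \<union> \<rho> \<in> ?J L" "P \<union> \<eta> \<subseteq> P \<union> \<rho>" using that by blast+
      then have "P \<union> \<rho> = P \<union> \<eta>" using m by (simp add: maximal_face_def)
      then have "\<rho> \<subseteq> \<eta>" using le[OF \<open>\<rho> \<in> L\<close>, of \<eta>] by simp
      with that show ?thesis by blast
    qed
    with that show "maximal_face L \<eta>" by (auto simp: maximal_face_def)
  next
    assume m: "maximal_face L \<eta>"
    have "\<zeta> = P \<union> \<eta>" if \<zeta>: "\<zeta> \<in> ?J L" "P \<union> \<eta> \<subseteq> \<zeta>" for \<zeta>
    proof -
      obtain \<rho> where \<rho>: "\<rho> \<in> L" "\<zeta> = P \<union> \<rho>" using \<zeta> X by blast
      then have "\<eta> \<subseteq> \<rho>" using le[OF \<open>\<eta> \<in> L\<close>, of \<rho>] \<zeta> by simp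
      then have "\<rho> = \<eta>" using m \<rho>(1) unfolding maximal_face_def by blast
      then show ?thesis using \<rho> by simp
    qed
    with that show "maximal_face (?J L) (P \<union> \<eta>)" by (auto simp: maximal_face_def)
  qed
  have "free_face (?J L) (P \<union> \<sigma>) (P \<union> \<tau>)"
    unfolding free_face_def
  proof (intro conjI allI impI)
    show "P \<union> \<sigma> \<in> ?J L" "P \<union> \<sigma> \<subseteq> P \<union> \<tau>" using \<sigma> by blast+
    show "maximal_face (?J L) (P \<union> \<tau>)" using max \<tau> by blast
    fix \<tau>' assume t: "maximal_face (?J L) \<tau>' \<and> P \<union> \<sigma> \<subseteq> \<tau>'"
    then have "\<tau>' \<in> ?J L" by (simp add: maximal_face_def)
    with t X obtain \<rho> where \<rho>: "\<rho> \<in> L" "\<tau>' = P \<union> \<rho>" by blast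
    then have "\<sigma> \<subseteq> \<rho>" "maximal_face L \<rho>" using t le[OF \<sigma>(1)] max by blast+
    then show "\<tau>' = P \<union> \<tau>" using *(1) \<rho> by (simp add: free_face_def)
  qed
  moreover have "?J M = ?J L - {\<eta>. P \<union> \<sigma> \<subseteq> \<eta> \<and> \<eta> \<subseteq> P \<union> \<tau>}"
  proof -
    have "\<eta> \<in> ?J M \<longleftrightarrow> \<eta> \<in> ?J L \<and> \<not> (P \<union> \<sigma> \<subseteq> \<eta> \<and> \<eta> \<subseteq> P \<union> \<tau>)" for \<eta>
    proof (cases "P \<subseteq> \<eta>")
      case False
      then show ?thesis by blast
    next
      case True
      \<comment> \<open>Uniqueness of the preimage matters: a face removed from the star must not
        reappear as the image of another member of \<open>M\<close>.\<close>
      have inj: "\<rho> = \<rho>'" if "\<rho> \<in> L" "\<rho>' \<in> L" "P \<union> \<rho> = P \<union> \<rho>'" for \<rho> \<rho>'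
        using le[OF that(1), of \<rho>'] le[OF that(2), of \<rho>] that(3) by blast
      have "\<eta> \<notin> X" using True X by blast
      show ?thesis
      proof (cases "\<exists>\<rho>\<in>L. \<eta> = P \<union> \<rho>")
        case False
        then have "\<eta> \<notin> (\<union>) P ` L" by blast
        moreover have "(\<union>) P ` M \<subseteq> (\<union>) P ` L" using *(3) by (intro image_mono) auto
        ultimately show ?thesis using \<open>\<eta> \<notin> X\<close> by (auto simp del: image_iff)
      next
        case True
        then obtain \<rho> where \<rho>: "\<rho> \<in> L" "\<eta> = P \<union> \<rho>" by blast
        have "\<rho>' = \<rho>" if \<rho>': "\<rho>' \<in> M" "\<eta> = P \<union> \<rho>'" for \<rho>'
        proof -
          have "\<rho>' \<in> L" using \<rho>'(1) unfolding *(3) by (rule DiffD1)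
          moreover have "P \<union> \<rho>' = P \<union> \<rho>" using \<rho>(2) unfolding \<rho>'(2) .
          ultimately show ?thesis using \<rho>(1) inj by simp
        qed
        then have "\<eta> \<in> (\<union>) P ` M \<longleftrightarrow> \<rho> \<in> M" unfolding image_iff using \<rho>(2) by blast
        then have "\<eta> \<in> ?J M \<longleftrightarrow> \<rho> \<in> M" using \<open>\<eta> \<notin> X\<close> by simp
        also have "\<dots> \<longleftrightarrow> \<not> (\<sigma> \<subseteq> \<rho> \<and> \<rho> \<subseteq> \<tau>)" using \<rho>(1) *(3) by blast
        also have "\<dots> \<longleftrightarrow> \<not> (P \<union> \<sigma> \<subseteq> \<eta> \<and> \<eta> \<subseteq> P \<union> \<tau>)"
          using le[OF \<sigma>(1), of \<rho>] le[OF \<rho>(1), of \<tau>] \<rho>(2) by simp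
        finally show ?thesis using \<rho> by simp
      qed
    qed
    then show ?thesis by (intro set_eqI) (simp only: Diff_iff mem_Collect_eq)
  qed
  moreover have "card (P \<union> \<sigma>) \<le> d + card P"
    using card_Un_le[of P \<sigma>] *(2) by linarith
  ultimately have "elementary_collapse (d + card P) (?J L) (?J M)"
    unfolding elementary_collapse_def by blast
  moreover have "(elementary_collapse (d + card P))\<^sup>*\<^sup>* (?J M) X"
    using step.IH step.prems elementary_collapse_subset[OF step.hyps(1)] by blast
  ultimately show ?case by (rule converse_rtranclp_into_rtranclp)
qed

text \<open>First the faces above \<open>P\<close> are collapsed away along the link, then what is
  left is collapsed by the first assumption.\<close>

lemma collapsible_link:
  assumes "collapsible (d + card P) {\<eta> \<in> X. \<not> P \<subseteq> \<eta>}"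
    and "collapsible d {\<sigma>. \<sigma> \<inter> P = {} \<and> P \<union> \<sigma> \<in> X}"
  shows "collapsible (d + card P) X"
proof -
  let ?D = "{\<eta> \<in> X. \<not> P \<subseteq> \<eta>}" and ?L = "{\<sigma>. \<sigma> \<inter> P = {} \<and> P \<union> \<sigma> \<in> X}"
  have "\<eta> \<in> (\<union>) P ` ?L" if "\<eta> \<in> X" "P \<subseteq> \<eta>" for \<eta>
    using that by (intro image_eqI[of _ _ "\<eta> - P"]) (auto simp: Un_absorb1)
  then have "?D \<union> (\<union>) P ` ?L = X" by blast
  moreover have "(elementary_collapse (d + card P))\<^sup>*\<^sup>* (?D \<union> (\<union>) P ` ?L) ?D"
    by (rule collapses_star) (use assms(2) in \<open>auto simp: collapsible_def\<close>)
  ultimately have "(elementary_collapse (d + card P))\<^sup>*\<^sup>* X ?D" by (simp only:)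
  then show ?thesis
    using assms(1) unfolding collapsible_def by (rule rtranclp_trans)
qed

section \<open>Independence numbers of vertex subsets\<close>

abbreviation ind_num :: "'a set set \<Rightarrow> 'a set \<Rightarrow> nat" where
  "ind_num E U \<equiv> independence_number U (induced_edges U E)"

lemma card_le_ind_num:
  assumes "finite U" "S \<subseteq> U" "indep S E"
  shows "card S \<le> ind_num E U"
  using independence_number_induced_less_iff[OF assms(1), of E "card S"] assms(2,3)
  by (meson less_irrefl not_le)

lemma ind_num_attained:
  assumes "finite U"
  obtains S where "S \<subseteq> U" "indep S E" "card S = ind_num E U"
proof -
  obtain S where S: "S \<subseteq> U" "indep S E" "\<not> card S < ind_num E U"
    using independence_number_induced_less_iff[OF assms, of E "ind_num E U"] by blast
  then have "card S = ind_num E U" using card_le_ind_num[OF assms S(1,2)] by linarith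
  with S that show ?thesis by blast
qed

lemma ind_num_mono:
  assumes "finite U" "T \<subseteq> U"
  shows "ind_num E T \<le> ind_num E U"
proof -
  obtain S where "S \<subseteq> T" "indep S E" "card S = ind_num E T"
    using ind_num_attained[OF finite_subset[OF assms(2,1)]] .
  then show ?thesis using card_le_ind_num[OF assms(1), of S E] assms(2) by simp
qed

text \<open>This additivity drives the counting below: it separates a vertex from its non-neighbours
  and a bad set from the rest of the graph.\<close>

lemma ind_num_Un:
  assumes "finite S" "finite T" "S \<inter> T = {}"
    and no_edge: "\<And>x y. x \<in> S \<Longrightarrow> y \<in> T \<Longrightarrow> {x, y} \<notin> E"
  shows "ind_num E (S \<union> T) = ind_num E S + ind_num E T"
proof (rule antisym)
  obtain A where A: "A \<subseteq> S \<union> T" "indep A E" "card A = ind_num E (S \<union> T)"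
    using ind_num_attained[of "S \<union> T"] assms(1,2) by blast
  have "A = (A \<inter> S) \<union> (A \<inter> T)" using A by blast
  then have "card A \<le> card (A \<inter> S) + card (A \<inter> T)" by (metis card_Un_le)
  also have "\<dots> \<le> ind_num E S + ind_num E T"
    using A assms(1,2) by (intro add_mono card_le_ind_num) (auto simp: indep_def)
  finally show "ind_num E (S \<union> T) \<le> ind_num E S + ind_num E T" using A by simp
next
  obtain A where A: "A \<subseteq> S" "indep A E" "card A = ind_num E S"
    using ind_num_attained[OF assms(1)] .
  obtain B where B: "B \<subseteq> T" "indep B E" "card B = ind_num E T"
    using ind_num_attained[OF assms(2)] .
  have no: "{x, y} \<notin> E" "{y, x} \<notin> E" if "x \<in> A" "y \<in> B" for x y
    using that A B no_edge[of x y] by (auto simp: insert_commute)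
  have "indep (A \<union> B) E"
    using A(2) B(2) no by (auto simp: indep_def)
  then have "card (A \<union> B) \<le> ind_num E (S \<union> T)"
    using A B assms by (intro card_le_ind_num) auto
  moreover have "card (A \<union> B) = card A + card B"
    using A B assms by (intro card_Un_disjoint) (auto intro: finite_subset)
  ultimately show "ind_num E S + ind_num E T \<le> ind_num E (S \<union> T)" using A B by simp
qed

lemma ind_num_singleton: "1 \<le> ind_num E {u}"
  using card_le_ind_num[of "{u}" "{u}" E] by (simp add: indep_def)

section \<open>Bad sets and their cores\<close>

text \<open>\<Delta> \<ge> 1 allows \<Delta> to be cancelled in \<open>bad_remove\<close>; for
  \<Delta> = 0 the final bound fails, as \<open>max_degree_zero_counterexample\<close>
  shows.\<close>

locale bounded_degree_graph =
  fixes V :: "'a set" and E :: "'a set set" and \<Delta> :: nat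
  assumes graph: "finite_simple_graph V E"
    and max_degree: "max_degree V E \<le> \<Delta>"
    and \<Delta>_pos: "\<Delta> \<ge> 1"
begin

abbreviation \<alpha> :: "'a set \<Rightarrow> nat" where
  "\<alpha> \<equiv> ind_num E"

definition bad :: "'a set \<Rightarrow> bool" where
  "bad B \<longleftrightarrow> B \<subseteq> V \<and> \<Delta> * \<alpha> B < card B \<and> (\<forall>U\<subset>B. card U \<le> \<Delta> * \<alpha> U)"

section \<open>Neighbour counts and the existence of bad sets\<close>

lemma finite_V: "finite V"
  using graph by (simp add: finite_simple_graph_def)

lemma finite_subset_V: "U \<subseteq> V \<Longrightarrow> finite U"
  using finite_V finite_subset by blast

lemma edge_in_V: "{u, w} \<in> E \<Longrightarrow> u \<in> V \<and> w \<in> V \<and> u \<noteq> w"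
  using graph by (force simp: finite_simple_graph_def nsets_def card_2_iff)

lemma card_neighbours_le:
  assumes "u \<in> V"
  shows "card {w. {u, w} \<in> E} \<le> \<Delta>"
proof -
  have fin: "finite E"
    using graph finite_V finite_imp_finite_nsets by (auto simp: finite_simple_graph_def intro: finite_subset)
  have "inj_on (\<lambda>w. {u, w}) {w. {u, w} \<in> E}"
    by (auto simp: inj_on_def doubleton_eq_iff)
  then have "card {w. {u, w} \<in> E} \<le> card {e \<in> E. u \<in> e}"
    by (rule card_inj_on_le) (use fin in auto)
  also have "\<dots> \<le> max_degree V E"
    unfolding max_degree_def degree_def[symmetric] using assms finite_V by (intro Max_ge) auto
  finally show ?thesis using max_degree by simp
qed

text \<open>Passing to smaller violating subsets ends at a minimal one. Read contrapositively, a
  face without bad subsets has at most \<Delta> times its independence number many vertices.\<close>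

lemma contains_bad:
  assumes "U \<subseteq> V" "\<Delta> * \<alpha> U < card U"
  obtains B where "bad B" "B \<subseteq> U"
proof -
  have "\<exists>B. bad B \<and> B \<subseteq> U" using assms
  proof (induction "card U" arbitrary: U rule: less_induct)
    case less
    show ?case
    proof (cases "bad U")
      case False
      then obtain W where W: "W \<subset> U" "\<not> card W \<le> \<Delta> * \<alpha> W"
        using less.prems unfolding bad_def by blast
      have "card W < card U" using finite_subset_V[OF less.prems(1)] W(1) by (rule psubset_card_mono)
      moreover have "W \<subseteq> V" using W less.prems by blast
      ultimately obtain B where "bad B" "B \<subseteq> W" using less.hyps[of W] W(2) by (metis not_le)
      with W show ?thesis by blast
    qed blast
  qed
  with that show ?thesis by blast
qed

section \<open>Structure of bad sets\<close>

lemma finite_bad: "bad B \<Longrightarrow> finite B"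
  by (auto simp: bad_def intro: finite_subset_V)

lemma bad_closed:
  assumes "bad B" "u \<in> B" "{u, w} \<in> E"
  shows "w \<in> B"
proof (rule ccontr)
  assume "w \<notin> B"
  let ?N = "{w. {u, w} \<in> E}"
  let ?U = "B - insert u ?N"
  have finB: "finite B" using finite_bad assms by blast
  have finN: "finite ?N" by (rule finite_subset[OF _ finite_V]) (use edge_in_V in blast)
  have uV: "u \<in> V" using edge_in_V assms by blast
  \<comment> \<open>The neighbour \<open>w\<close> outside \<open>B\<close> makes this inclusion
    strict, so at most \<Delta> - 1 neighbours lie in \<open>B\<close>; together with
    \<open>u\<close> itself at most \<Delta> vertices are deleted.\<close>
  have "B \<inter> ?N \<subset> ?N" using assms \<open>w \<notin> B\<close> by blast
  then have "card (B \<inter> ?N) < card ?N" using finN by (rule psubset_card_mono[rotated])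
  then have "card (insert u (B \<inter> ?N)) \<le> \<Delta>"
    using card_neighbours_le[OF uV] card_insert_le_m1[of "card ?N" "B \<inter> ?N" u] by linarith
  moreover have "card B \<le> card ?U + card (insert u (B \<inter> ?N))"
    using card_Un_le[of ?U "insert u (B \<inter> ?N)"] assms(2)
    by (metis (no_types, lifting) Diff_insert_absorb Int_insert_right_if1 Un_Diff_Int inf_commute)
  moreover have "card ?U \<le> \<Delta> * \<alpha> ?U"
    using assms(1,2) unfolding bad_def by blast
  \<comment> \<open>No neighbour of \<open>u\<close> is left in \<open>?U\<close>, so
    \<open>u\<close> extends any independent set there. The deletion thus costs at most \<Delta>
    vertices and lowers \<alpha> by at least one, which contradicts the excess of
    \<open>B\<close>.\<close>
  moreover have "\<alpha> ?U + 1 \<le> \<alpha> B"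
  proof -
    have "\<alpha> ?U + \<alpha> {u} = \<alpha> (?U \<union> {u})"
      using finB by (intro ind_num_Un[symmetric]) (auto simp: insert_commute)
    also have "\<dots> \<le> \<alpha> B" using finB assms(2) by (intro ind_num_mono) auto
    finally show ?thesis using ind_num_singleton[of u E] by linarith
  qed
  then have "\<Delta> * \<alpha> ?U + \<Delta> \<le> \<Delta> * \<alpha> B"
    by (metis add_mult_distrib2 mult.right_neutral mult_le_mono2)
  moreover have "\<Delta> * \<alpha> B < card B" using assms(1) by (simp add: bad_def)
  ultimately show False by linarith
qed

lemma bad_no_edge_out: "bad B \<Longrightarrow> u \<in> B \<Longrightarrow> w \<notin> B \<Longrightarrow> {u, w} \<notin> E \<and> {w, u} \<notin> E"
  using bad_closed by (metis insert_commute)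

lemma bad_nonempty: "bad B \<Longrightarrow> B \<noteq> {}"
  by (auto simp: bad_def)

text \<open>The chain card (B - {v}) \<le> \<Delta> * \<alpha> (B - {v}) \<le> \<Delta> * \<alpha> B
  \<le> card B - 1 begins and ends with the same number, so equality holds throughout.\<close>

lemma bad_remove:
  assumes "bad B" "v \<in> B"
  shows "\<alpha> (B - {v}) = \<alpha> B" "card (B - {v}) = \<Delta> * \<alpha> B"
proof -
  have fin: "finite B" using finite_bad assms by blast
  have "card (B - {v}) \<le> \<Delta> * \<alpha> (B - {v})" "\<Delta> * \<alpha> B < card B"
    using assms unfolding bad_def by blast+
  moreover have "\<alpha> (B - {v}) \<le> \<alpha> B" using fin by (intro ind_num_mono) auto
  then have "\<Delta> * \<alpha> (B - {v}) \<le> \<Delta> * \<alpha> B" by simp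
  moreover have "card B = card (B - {v}) + 1"
    using card.remove[OF fin assms(2)] by simp
  ultimately have "\<Delta> * \<alpha> (B - {v}) = \<Delta> * \<alpha> B" "card (B - {v}) = \<Delta> * \<alpha> B" by linarith+
  then show "\<alpha> (B - {v}) = \<alpha> B" "card (B - {v}) = \<Delta> * \<alpha> B" using \<Delta>_pos by simp_all
qed

text \<open>If the sets met, \<open>B\<close> would split \<open>A\<close> into two proper parts
  with no edge between them. Neither part exceeds its bound by minimality of \<open>A\<close>, and
  both sides add up, so \<open>A\<close> would not exceed its bound either.\<close>

lemma bad_disjoint:
  assumes "bad A" "bad B" "A \<noteq> B"
  shows "A \<inter> B = {}"
proof (rule ccontr)
  assume ne: "A \<inter> B \<noteq> {}"
  have "\<not> A \<subset> B" using assms unfolding bad_def by (meson leD)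
  then have "A \<inter> B \<subset> A" using assms(3) by blast
  moreover have "A - B \<subset> A" using ne by blast
  ultimately have le: "card (A \<inter> B) \<le> \<Delta> * \<alpha> (A \<inter> B)" "card (A - B) \<le> \<Delta> * \<alpha> (A - B)"
    and gt: "\<Delta> * \<alpha> A < card A"
    using assms(1) unfolding bad_def by blast+
  have fin: "finite A" using finite_bad assms by blast
  have "\<alpha> A = \<alpha> ((A \<inter> B) \<union> (A - B))" by (simp add: Un_Diff_Int Un_commute)
  also have "\<dots> = \<alpha> (A \<inter> B) + \<alpha> (A - B)"
    using fin bad_no_edge_out[OF assms(2)] by (intro ind_num_Un) auto
  finally have "\<Delta> * \<alpha> A = \<Delta> * \<alpha> (A \<inter> B) + \<Delta> * \<alpha> (A - B)" by (simp add: algebra_simps)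
  moreover have "card A = card (A \<inter> B) + card (A - B)"
    using card_Int_Diff[OF fin] .
  ultimately show False using le gt by linarith
qed

section \<open>Cores and the complexes avoiding them\<close>

definition apex :: "'a set \<Rightarrow> 'a" where
  "apex B = (SOME v. v \<in> B)"

text \<open>This is the set \<open>P\<close> of the overview. Putting \<open>apex B\<close> back
  does not raise the independence number, which makes it a cone point of the link.\<close>

definition core :: "'a set \<Rightarrow> 'a set" where
  "core B = B - {apex B}"

lemma apex_in: "bad B \<Longrightarrow> apex B \<in> B"
  using bad_nonempty by (metis apex_def some_in_eq)

text \<open>Both parameters serve the induction: \<open>W\<close> shrinks when passing to a link,
  and \<open>Q\<close> records the bad sets whose cores have already been collapsed away.\<close>

definition avoiding_complex :: "'a set \<Rightarrow> 'a set set \<Rightarrow> nat \<Rightarrow> 'a set set" where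
  "avoiding_complex W Q n = {U. U \<subseteq> W \<and> \<alpha> U < n \<and> (\<forall>B\<in>Q. \<not> core B \<subseteq> U)}"

text \<open>No edge leaves \<open>B\<close>, so \<open>B\<close> contributes exactly \<alpha> B to
  the independence number, with or without the apex. The cores of the sets in \<open>Q\<close> are
  disjoint from \<open>B\<close>, so adding \<open>core B\<close> does not affect whether they are
  avoided.\<close>

lemma avoiding_complex_link:
  assumes B: "bad B" "B \<subseteq> W" "B \<notin> Q" and Q: "Q \<subseteq> Collect bad" and W: "W \<subseteq> V"
  shows "{\<sigma>. \<sigma> \<inter> core B = {} \<and> core B \<union> \<sigma> \<in> avoiding_complex W Q n} =
    {\<eta>. \<eta> - {apex B} \<in> avoiding_complex (W - B) Q (n - \<alpha> B)}"
proof -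
  have eqv: "\<sigma> \<inter> core B = {} \<and> \<sigma> \<subseteq> W \<longleftrightarrow> \<sigma> - {apex B} \<subseteq> W - B" for \<sigma>
    using apex_in[OF B(1)] B(2) by (auto simp: core_def)
  have coreW: "core B \<subseteq> W" using B by (auto simp: core_def)
  have iff: "core B \<union> \<sigma> \<in> avoiding_complex W Q n \<longleftrightarrow>
      \<sigma> - {apex B} \<in> avoiding_complex (W - B) Q (n - \<alpha> B)"
    if s: "\<sigma> - {apex B} \<subseteq> W - B" for \<sigma>
  proof -
    \<comment> \<open>The face splits into its part \<open>?T\<close> inside \<open>B\<close>, which
      is \<open>core B\<close> or all of \<open>B\<close>, and its part \<open>?\<rho>\<close>
      outside.\<close>
    let ?\<rho> = "\<sigma> - {apex B}" and ?T = "core B \<union> (\<sigma> \<inter> {apex B})"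
    have T: "core B \<subseteq> ?T" "?T \<subseteq> B" using apex_in[OF B(1)] by (auto simp: core_def)
    have fin: "finite B" "finite ?T" "finite ?\<rho>"
      using finite_bad[OF B(1)] finite_subset[OF T(2)] finite_subset_V[of ?\<rho>] s W by blast+
    have "\<alpha> (core B) \<le> \<alpha> ?T" "\<alpha> ?T \<le> \<alpha> B"
      using T fin by (auto intro: ind_num_mono)
    then have aT: "\<alpha> ?T = \<alpha> B" using bad_remove(1)[OF B(1) apex_in[OF B(1)]] by (simp add: core_def)
    have u: "core B \<union> \<sigma> = ?T \<union> ?\<rho>" by blast
    have "\<alpha> (?T \<union> ?\<rho>) = \<alpha> ?T + \<alpha> ?\<rho>"
    proof (rule ind_num_Un[OF fin(2,3)])
      show "?T \<inter> ?\<rho> = {}" using T s by blast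
      show "{x, y} \<notin> E" if "x \<in> ?T" "y \<in> ?\<rho>" for x y
      proof -
        have "x \<in> B" "y \<notin> B" using subsetD[OF T(2) that(1)] subsetD[OF s that(2)] by simp_all
        then show ?thesis using bad_no_edge_out[OF B(1)] by simp
      qed
    qed
    \<comment> \<open>Truncated subtraction is harmless: if \<alpha> B \<ge> n, both sides are
      false.\<close>
    then have "\<alpha> (core B \<union> \<sigma>) < n \<longleftrightarrow> \<alpha> ?\<rho> < n - \<alpha> B" using aT u by auto
    moreover have "core A \<subseteq> core B \<union> \<sigma> \<longleftrightarrow> core A \<subseteq> ?\<rho>" if "A \<in> Q" for A
    proof -
      have "A \<inter> B = {}" using bad_disjoint[of A B] that B Q by blast
      then have "core A \<inter> ?T = {}" using T(2) unfolding core_def by blast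
      then show ?thesis unfolding u by blast
    qed
    moreover have "core B \<union> \<sigma> \<subseteq> W" using eqv[of \<sigma>] s coreW by simp
    ultimately show ?thesis
      using s by (simp add: avoiding_complex_def)
  qed
  show ?thesis
  proof (intro Collect_cong iffI)
    fix \<sigma> assume *: "\<sigma> \<inter> core B = {} \<and> core B \<union> \<sigma> \<in> avoiding_complex W Q n"
    then have "\<sigma> - {apex B} \<subseteq> W - B" using eqv[of \<sigma>] by (simp add: avoiding_complex_def)
    with * iff show "\<sigma> - {apex B} \<in> avoiding_complex (W - B) Q (n - \<alpha> B)" by simp
  next
    fix \<sigma> assume *: "\<sigma> - {apex B} \<in> avoiding_complex (W - B) Q (n - \<alpha> B)"
    then have "\<sigma> - {apex B} \<subseteq> W - B" by (simp add: avoiding_complex_def)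
    with * iff[of \<sigma>] eqv[of \<sigma>] show "\<sigma> \<inter> core B = {} \<and> core B \<union> \<sigma> \<in> avoiding_complex W Q n" by simp
  qed
qed

text \<open>Induction on the number of bad sets in \<open>W\<close> whose cores are not yet
  forbidden. Choosing such a \<open>B\<close>, the deletion moves \<open>B\<close> into
  \<open>Q\<close> and the link removes \<open>B\<close> from \<open>W\<close>; either way the
  number drops.\<close>

lemma collapsible_avoiding_complex:
  assumes "W \<subseteq> V" "Q \<subseteq> Collect bad"
    and "\<And>B. bad B \<Longrightarrow> B \<subseteq> W \<or> B \<inter> W = {}"
  shows "collapsible (\<Delta> * (n - 1)) (avoiding_complex W Q n)"
  using assms
proof (induction "card {B. bad B \<and> B \<subseteq> W \<and> B \<notin> Q}" arbitrary: W Q n rule: less_induct)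
  case less
  let ?R = "\<lambda>W Q. {B. bad B \<and> B \<subseteq> W \<and> B \<notin> Q}"
  have finR: "finite (?R W Q)"
    by (rule finite_subset[of _ "Pow V"]) (auto simp: bad_def finite_V)
  have finW: "finite W" using finite_subset_V less.prems by blast
  have finX: "finite (avoiding_complex W Q n)"
    by (rule finite_subset[of _ "Pow W"]) (auto simp: avoiding_complex_def finW)
  show ?case
  proof (cases "?R W Q = {}")
    case True
    have "finite U \<and> card U \<le> \<Delta> * (n - 1)" if U: "U \<in> avoiding_complex W Q n" for U
    proof -
      have UW: "U \<subseteq> W" "\<alpha> U < n" using U by (auto simp: avoiding_complex_def)
      \<comment> \<open>All bad subsets of \<open>W\<close> are in \<open>Q\<close> now, so a bad
        subset of \<open>U\<close> would bring a forbidden core with it.\<close>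
      have "card U \<le> \<Delta> * \<alpha> U"
      proof (rule ccontr)
        assume "\<not> card U \<le> \<Delta> * \<alpha> U"
        then obtain B where "bad B" "B \<subseteq> U"
          using contains_bad[of U] UW less.prems by (metis not_le subset_trans)
        moreover from this have "B \<in> Q" using True UW by blast
        ultimately show False using U by (auto simp: avoiding_complex_def core_def)
      qed
      also have "\<dots> \<le> \<Delta> * (n - 1)" using UW by (intro mult_le_mono2) simp
      finally show ?thesis using UW finW finite_subset by blast
    qed
    with finX show ?thesis by (blast intro: collapsible_if_card_le)
  next
    case False
    then obtain B where B: "bad B" "B \<subseteq> W" "B \<notin> Q" by blast
    have "?R W (insert B Q) \<subset> ?R W Q" using B by blast
    then have "card (?R W (insert B Q)) < card (?R W Q)" using finR by (rule psubset_card_mono[rotated])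
    then have deletion: "collapsible (\<Delta> * (n - 1)) (avoiding_complex W (insert B Q) n)"
      using less.hyps[of W "insert B Q"] less.prems B by blast
    have ins: "avoiding_complex W (insert B Q) n = {\<eta> \<in> avoiding_complex W Q n. \<not> core B \<subseteq> \<eta>}"
      by (auto simp: avoiding_complex_def)
    let ?k = "\<alpha> B"
    have cardP: "card (core B) = \<Delta> * ?k"
      using bad_remove(2)[OF B(1) apex_in[OF B(1)]] by (simp add: core_def)
    let ?Y = "avoiding_complex (W - B) Q (n - ?k)"
    have "B \<notin> ?R (W - B) Q" "?R (W - B) Q \<subseteq> ?R W Q" using bad_nonempty by blast+
    then have "?R (W - B) Q \<subset> ?R W Q" using B by blast
    then have "card (?R (W - B) Q) < card (?R W Q)" using finR by (rule psubset_card_mono[rotated])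
    \<comment> \<open>The invariant on \<open>W\<close> survives the removal of \<open>B\<close>
      because bad sets are pairwise disjoint.\<close>
    moreover have "A \<subseteq> W - B \<or> A \<inter> (W - B) = {}" if "bad A" for A
      using less.prems(3)[OF that] bad_disjoint[OF that B(1)] by blast
    ultimately have "collapsible (\<Delta> * (n - ?k - 1)) ?Y"
      using less.hyps[of "W - B" Q] less.prems by blast
    \<comment> \<open>The apex lies in \<open>B\<close>, hence outside every face of
      \<open>?Y\<close>, so coning is possible.\<close>
    then have "collapsible (\<Delta> * (n - ?k - 1)) {\<eta>. \<eta> - {apex B} \<in> ?Y}"
      by (rule collapsible_cone) (use apex_in[OF B(1)] in \<open>auto simp: avoiding_complex_def\<close>)
    then have link: "collapsible (\<Delta> * (n - ?k - 1))
        {\<sigma>. \<sigma> \<inter> core B = {} \<and> core B \<union> \<sigma> \<in> avoiding_complex W Q n}"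
      using avoiding_complex_link[OF B less.prems(2,1)] by simp
    show ?thesis
    proof (cases "?k < n")
      case True
      \<comment> \<open>The link needs only \<Delta> * (n - ?k - 1), and the core has exactly
        \<Delta> * ?k vertices, so the total is the desired bound with no loss.\<close>
      then have "n - 1 = (n - ?k - 1) + ?k" by simp
      then have "\<Delta> * (n - 1) = \<Delta> * (n - ?k - 1) + card (core B)"
        by (metis cardP add_mult_distrib2)
      with link deletion show ?thesis by (simp only: ins collapsible_link)
    next
      case False
      \<comment> \<open>The core alone already has independence number \<alpha> B \<ge> n, so no
        face contains it and forbidding it changes nothing.\<close>
      have "\<not> core B \<subseteq> U" if "U \<in> avoiding_complex W Q n" for U
      proof
        assume "core B \<subseteq> U"
        moreover have "finite U"
          using that finite_subset[OF _ finW] by (simp add: avoiding_complex_def)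
        ultimately have "\<alpha> (core B) \<le> \<alpha> U" by (intro ind_num_mono)
        then show False
          using that False bad_remove(1)[OF B(1) apex_in[OF B(1)]]
          by (simp add: avoiding_complex_def core_def)
      qed
      then have "avoiding_complex W (insert B Q) n = avoiding_complex W Q n" using ins by blast
      with deletion show ?thesis by simp
    qed
  qed
qed

end

theorem theorem1p6:
  fixes V :: "'a set" and E :: "'a set set" and \<Delta> n :: nat
  assumes "finite_simple_graph V E"
    and "max_degree V E \<le> \<Delta>"
    and "\<Delta> \<ge> 1"
    and "n \<ge> 1"
  shows "collapsibility_number (bounded_independence_complex n V E) \<le> \<Delta> * (n - 1)"
proof -
  interpret bounded_degree_graph V E \<Delta>
    using assms(1-3) by unfold_locales
  have "bounded_independence_complex n V E = avoiding_complex V {} n"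
    by (simp add: bounded_independence_complex_def avoiding_complex_def)
  moreover have "collapsible (\<Delta> * (n - 1)) (avoiding_complex V {} n)"
    by (rule collapsible_avoiding_complex) (auto simp: bad_def)
  ultimately show ?thesis
    unfolding collapsibility_number_def by (simp add: Least_le)
qed

end
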